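(* Let $f=f_{(\xi,\zeta)}$ be a piecewise-linear map on $\Omega\subset\mathbb{R}^2$ with pieces $f_1,\dots,f_m$, regions $\Omega_1,\dots,\Omega_m$ and switching set $\Sigma$, where $\Sigma$ and each $f_j$ depend smoothly on parameters $(\xi,\zeta)$ near $(0,0)\in\mathbb{R}^2$. Let $\mathcal{X}=\mathcal{X}_0\cdots\mathcal{X}_{n-1}$ and $\mathcal{Y}=\mathcal{Y}_0\cdots\mathcal{Y}_{p-1}$ be words of lengths $n,p\ge 1$ in the symbols $\{1,\dots,m\}$ with $\mathcal{X}_0\ne\mathcal{Y}_0$. Suppose that at $(\xi,\zeta)=(0,0)$: (1) $f$ has an admissible $\mathcal{X}$-cycle $\{P_0,\dots,P_{n-1}\}$ with no points on $\Sigma$, and the eigenvalues $a,b$ of $\mathrm{D}f_{\mathcal{X}}$ satisfy $0<|a|<1<b$; (2) $Z\in\Omega$ is a point at which the line $E^u(P_0)$ intersects $\Sigma$ transversely; (3) $\mathcal{L}(P_0,Z)\subset\mathrm{int}(\Omega_{\mathcal{X}})$ and $\mathcal{L}(Z,f_{\mathcal{X}}(Z))\subset\mathrm{int}(\Omega_{\mathcal{Y}})$; (4) $f_{\mathcal{Y}}(Z)\in\mathcal{B}\cap E^s(P_0)$ and $f_{\mathcal{Y}}(f_{\mathcal{X}}(Z))\in\mathcal{B}\cap E^s(P_0)$, where $\mathcal{B}$ is a compact convex set with $P_0\in\mathcal{B}\subset\mathrm{int}(\Omega_{\mathcal{X}\mathcal{X}})$. Let $\lambda=a(0,0)$, $\sigma=b(0,0)$,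 suppose $|\lambda|\sigma<1$, let $\gamma=\max\left[\sigma^{-3/2},|\lambda|^{1/2}\sigma^{-1/2}\right]$, and suppose the parameter map $\psi:(\xi,\zeta)\mapsto(\eta,\nu)$ defined in the context satisfies $\det(J)\ne0$ at $(\xi,\zeta)=(0,0)$. Given a neighbourhood $\mathcal{M}\subset\mathbb{R}^2$ of $\mathcal{L}(Z,f_{\mathcal{X}}(Z))$ (taken at $(\xi,\zeta)=(0,0)$) and a neighbourhood $\mathcal{N}$ of $(\xi,\zeta)=(0,0)$, let $S_k$ be the set of all $(\xi,\zeta)\in\mathcal{N}$ for which $f$ has an admissible, asymptotically stable $\mathcal{X}^k\mathcal{Y}$-cycle $\{\hat P_0^{(k)},\dots,\hat P_{kn+p-1}^{(k)}\}$ with $\hat P_{kn}^{(k)}\in\mathcal{M}$. Let $\mathcal{M}$ and $\mathcal{N}$ be such neighbourhoods for which there exists $k_{\min}\ge0$ such that, in $\mathcal{N}$, $\psi^{-1}(\Delta_{k,\gamma}^-)\subset S_k\subset\psi^{-1}(\Delta_{k,\gamma}^+)$ for all $k\ge k_{\min}$ (such $\mathcal{M},\mathcal{N}$ exist whenever $\mathcal{X}_0\ne\mathcal{Y}_0$, conditions (1)–(4) hold at $(\xi,\zeta)=(0,0)$, $|\lambda|\sigma<1$, and $\det(J)\ne0$ at $(\xi,\zeta)=(0,0)$). Let $j\ge1$ be an integer. Then, for all sufficiently large values of $k$, $S_k\cap S_{k+j}=\varnothing$ if and only if $j>1$.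
   Context: **Piecewise-linear maps.** $f:\Omega\to\mathbb{R}^2$, $\Omega\subset\mathbb{R}^2$, is given by $f(x,y)=f_j(x,y)$ for $(x,y)\in\Omega_j$, $j=1,\dots,m$, where $\Omega_1,\dots,\Omega_m$ partition $\Omega$ and each $f_j$ is affine (regarded as a map on all of $\mathbb{R}^2$). $f$ need not be continuous. $\Sigma$ is the set of all $P\in\Omega$ every neighbourhood of which intersects more than one $\Omega_j$; it is assumed to be a finite union of smooth curves. When parameters are present, $\Sigma$ (hence the regions) and each $f_j$ depend smoothly on them. **Words and cycles.** A word $\mathcal{W}=\mathcal{W}_0\cdots\mathcal{W}_{q-1}$ of length $q$ has $\mathcal{W}_i\in\{1,\dots,m\}$. $\mathcal{X}\mathcal{Y}$ denotes concatenation and $\mathcal{X}^k$ the concatenation of $k$ copies of $\mathcal{X}$. $f_{\mathcal{W}}=f_{\mathcal{W}_{q-1}}\circ\cdots\circ f_{\mathcal{W}_0}$, an affine map with constant Jacobian matrix $\mathrm{D}f_{\mathcal{W}}$. $\Omega_{\mathcal{W}}$ is the set of all $P\in\Omega$ with $f^i(P)\in\Omega_{\mathcal{W}_i}$ for all $i=0,\dots,q-1$. A $\mathcal{W}$-cycle is a $q$-tuple $\{P_0,\dots,P_{q-1}\}$ with $f_{\mathcal{W}_i}(P_i)=P_{i+1}$ for $0\le i\le q-2$ and $f_{\mathcal{W}_{q-1}}(P_{q-1})=P_0$. It is admissible if $P_0\in\Omega_{\mathcal{W}}$ (it is then a periodic solution of $f$). Asymptotic stability refers to stability as a periodic solution of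 $f$. **Subspaces and segments.** When the eigenvalues $a,b$ of $\mathrm{D}f_{\mathcal{X}}$ satisfy $0<|a|<1<b$, $E^s(P_0)$ and $E^u(P_0)$ are the lines through $P_0$ in the directions of eigenvectors of $\mathrm{D}f_{\mathcal{X}}$ for $a$ and $b$ respectively. $\mathcal{L}(P,Q)=\{(1-t)P+tQ\mid 0<t<1\}$. $\mathrm{int}(\cdot)$ denotes interior. **Coordinates.** Under hypotheses (1) and (2), the $\mathcal{X}$-cycle (hence $P_0$), the eigenvalues $a=a(\xi,\zeta)$, $b=b(\xi,\zeta)$, and the transverse intersection point $Z$ of $E^u(P_0)$ with $\Sigma$ persist and vary smoothly with $(\xi,\zeta)$ near $(0,0)$; these continuations are used below. Let $q_{\rm unstab}=Z-P_0$ (an eigenvector for $b$), let $q_{\rm stab}$ be a smoothly varying eigenvector of $\mathrm{D}f_{\mathcal{X}}$ for $a$, let $T=[\,q_{\rm stab}\ \ q_{\rm unstab}\,]$, and let $h(P)=(h_1(P),h_2(P))=T^{-1}(P-P_0)$. Define $$\eta=h_2\big(f_{\mathcal{Y}}(f_{\mathcal{X}}(Z))\big),\qquad \nu=h_2\big(f_{\mathcal{Y}}(Z)\big),$$ and $\psi(\xi,\zeta)=(\eta,\nu)$, with Jacobian matrix $J=\begin{bmatrix}\partial\eta/\partial\xi&\partial\eta/\partial\zeta\\ \partial\nu/\partial\xi&\partial\nu/\partial\zeta\end{bmatrix}$. (Hypothesis (4) gives $\psi(0,0)=(0,0)$; $\det J\ne0$ at $(0,0)$ makes $\psi$ locally invertible.)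 "In $\mathcal{N}$, $\psi^{-1}(\Delta)$" means $\{(\xi,\zeta)\in\mathcal{N}\mid\psi(\xi,\zeta)\in\Delta\}$. **Triangles.** For $k\ge0$ and $\gamma\ge 0$, $$\Delta_{k,\gamma}^{\pm}=\left\{(\eta,\nu)\ \middle|\ \eta<\sigma^{-(k-1)}\pm\gamma^k,\ \ \nu>\sigma^{-k}\mp\gamma^k,\ \ \nu<\eta+(\sigma-1)\sigma^{-k}\pm\gamma^k\right\}.$$ *)

theory Defs
  imports "HOL-Analysis.Analysis"
begin

type_synonym plane = "real ^ 2"

section \<open>Smooth maps\<close>

primrec times_differentiable_on ::
    "nat \<Rightarrow> ('a::real_normed_vector \<Rightarrow> 'b::real_normed_vector) \<Rightarrow> 'a set \<Rightarrow> bool" where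
  "times_differentiable_on 0 f S \<longleftrightarrow> continuous_on S f"
| "times_differentiable_on (Suc n) f S \<longleftrightarrow>
     (\<forall>x\<in>S. f differentiable (at x)) \<and>
     (\<forall>v. times_differentiable_on n (\<lambda>x. frechet_derivative f (at x) v) S)"

text \<open>
  Class \<open>C\<^sup>\<infinity>\<close>. Used only on open subsets of finite-dimensional spaces, where continuity of all
  iterated directional derivatives is the usual notion.
\<close>

definition smooth_on :: "('a::real_normed_vector \<Rightarrow> 'b::real_normed_vector) \<Rightarrow> 'a set \<Rightarrow> bool" where
  "smooth_on f S \<longleftrightarrow> (\<forall>n. times_differentiable_on n f S)"

section \<open>Piecewise-linear maps\<close>

text \<open>
  For a single map, \<open>R j\<close> is the region \<open>\<Omega>\<^sub>j\<close> and \<open>F j\<close> is the affine map \<open>f\<^sub>j\<close>,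
  for \<open>j \<in> {1..m}\<close>. A family depending on parameters has an additional first argument \<open>\<mu> = (\<xi>, \<zeta>)\<close>.
\<close>

definition affine_map :: "(plane \<Rightarrow> plane) \<Rightarrow> bool" where
  "affine_map g \<longleftrightarrow> (\<exists>(A :: real ^ 2 ^ 2) c. \<forall>P. g P = A *v P + c)"

text \<open>The value is meaningful only for \<open>P\<close> in the domain \<open>\<Omega>\<close>, the union of the regions.\<close>

definition pl_map :: "nat \<Rightarrow> (nat \<Rightarrow> plane set) \<Rightarrow> (nat \<Rightarrow> plane \<Rightarrow> plane) \<Rightarrow> plane \<Rightarrow> plane" where
  "pl_map m R F P = F (THE j. j \<in> {1..m} \<and> P \<in> R j) P"

definition switching_set :: "plane set \<Rightarrow> nat \<Rightarrow> (nat \<Rightarrow> plane set) \<Rightarrow> plane set" where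
  "switching_set Om m R =
     {P \<in> Om. \<forall>V. open V \<and> P \<in> V \<longrightarrow>
        (\<exists>i\<in>{1..m}. \<exists>j\<in>{1..m}. i \<noteq> j \<and> V \<inter> R i \<noteq> {} \<and> V \<inter> R j \<noteq> {})}"

text \<open>
  A finite union of smooth regular curves depending smoothly on \<open>\<mu> \<in> U\<close>. The parameter intervals
  \<open>T i\<close> may or may not contain their endpoints; smoothness at an endpoint is that of an extension to
  the open set \<open>I i\<close>.
\<close>

definition smooth_curve_family :: "plane set \<Rightarrow> (plane \<Rightarrow> plane set) \<Rightarrow> bool" where
  "smooth_curve_family U Sig \<longleftrightarrow>
     (\<exists>(N::nat) (c :: nat \<Rightarrow> plane \<Rightarrow> real \<Rightarrow> plane) (I :: nat \<Rightarrow> real set) (T :: nat \<Rightarrow> real set).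
        (\<forall>i<N. open (I i) \<and> T i \<subseteq> I i \<and> is_interval (T i) \<and> interior (T i) \<noteq> {} \<and>
               smooth_on (\<lambda>(\<mu>, t). c i \<mu> t) (U \<times> I i) \<and>
               (\<forall>\<mu>\<in>U. \<forall>t\<in>T i. vector_derivative (c i \<mu>) (at t) \<noteq> 0)) \<and>
        (\<forall>\<mu>\<in>U. Sig \<mu> = (\<Union>i<N. c i \<mu> ` T i)))"

text \<open>
  The last conjunct of the next definition makes precise that the regions move with the switching
  set: away from it, a point keeps its region under small changes of the point and the parameters.
\<close>

definition smooth_pl_family ::
    "plane set \<Rightarrow> plane set \<Rightarrow> nat \<Rightarrow> (plane \<Rightarrow> nat \<Rightarrow> plane set) \<Rightarrow>
     (plane \<Rightarrow> nat \<Rightarrow> plane \<Rightarrow> plane) \<Rightarrow> bool" where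
  "smooth_pl_family U Om m R F \<longleftrightarrow>
     open U \<and> 0 \<in> U \<and>
     (\<forall>\<mu>\<in>U. (\<Union>j\<in>{1..m}. R \<mu> j) = Om \<and> disjoint_family_on (R \<mu>) {1..m}) \<and>
     (\<forall>\<mu>\<in>U. \<forall>j\<in>{1..m}. affine_map (F \<mu> j)) \<and>
     (\<forall>j\<in>{1..m}. smooth_on (\<lambda>(\<mu>, P). F \<mu> j P) (U \<times> UNIV)) \<and>
     smooth_curve_family U (\<lambda>\<mu>. switching_set Om m (R \<mu>)) \<and>
     (\<forall>\<mu>\<in>U. \<forall>j\<in>{1..m}. \<forall>P \<in> R \<mu> j - switching_set Om m (R \<mu>).
        \<forall>\<^sub>F (\<mu>', P') in nhds (\<mu>, P). P' \<in> Om \<longrightarrow> P' \<in> R \<mu>' j)"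

section \<open>Words and cycles\<close>

definition word_pow :: "nat list \<Rightarrow> nat \<Rightarrow> nat list" where
  "word_pow X k = concat (replicate k X)"

text \<open>The letter \<open>W ! 0\<close> acts first.\<close>

definition word_map :: "(nat \<Rightarrow> plane \<Rightarrow> plane) \<Rightarrow> nat list \<Rightarrow> plane \<Rightarrow> plane" where
  "word_map F W = fold F W"

text \<open>The Jacobian matrix is constant for affine pieces; it is evaluated at the origin.\<close>

definition word_jacobian :: "(nat \<Rightarrow> plane \<Rightarrow> plane) \<Rightarrow> nat list \<Rightarrow> real ^ 2 ^ 2" where
  "word_jacobian F W = jacobian (word_map F W) (at 0)"

text \<open>
  Membership forces \<open>P, f P, \<dots>, f\<^sup>q\<^sup>-\<^sup>1 P\<close> to lie in \<open>\<Omega>\<close>, so all the iterates used are meaningful.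
\<close>

definition word_region ::
    "plane set \<Rightarrow> nat \<Rightarrow> (nat \<Rightarrow> plane set) \<Rightarrow> (nat \<Rightarrow> plane \<Rightarrow> plane) \<Rightarrow> nat list \<Rightarrow> plane set" where
  "word_region Om m R F W =
     {P \<in> Om. \<forall>i<length W. (pl_map m R F ^^ i) P \<in> R (W ! i)}"

definition is_cycle :: "(nat \<Rightarrow> plane \<Rightarrow> plane) \<Rightarrow> nat list \<Rightarrow> plane list \<Rightarrow> bool" where
  "is_cycle F W Ps \<longleftrightarrow> length Ps = length W \<and>
     (\<forall>i<length W. F (W ! i) (Ps ! i) = Ps ! (Suc i mod length W))"

definition admissible_cycle ::
    "plane set \<Rightarrow> nat \<Rightarrow> (nat \<Rightarrow> plane set) \<Rightarrow> (nat \<Rightarrow> plane \<Rightarrow> plane) \<Rightarrow> nat list \<Rightarrow> plane list \<Rightarrow> bool" where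
  "admissible_cycle Om m R F W Ps \<longleftrightarrow> is_cycle F W Ps \<and> Ps ! 0 \<in> word_region Om m R F W"

text \<open>
  Asymptotic stability, in the sense of Lyapunov, of a periodic solution of \<open>f : \<Omega> \<rightarrow> \<real>\<^sup>2\<close>.
  As \<open>f\<close> need not map \<open>\<Omega>\<close> into itself, nearby orbits are required to remain in \<open>\<Omega>\<close>; as it need
  not be continuous, every initial phase \<open>i\<close> is considered.
\<close>

definition asymptotically_stable :: "plane set \<Rightarrow> (plane \<Rightarrow> plane) \<Rightarrow> plane list \<Rightarrow> bool" where
  "asymptotically_stable Om f Ps \<longleftrightarrow>
     (\<forall>\<epsilon>>0. \<exists>\<delta>>0. \<forall>i<length Ps. \<forall>Q\<in>Om. dist Q (Ps ! i) < \<delta> \<longrightarrow>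
        (\<forall>t. (f ^^ t) Q \<in> Om \<and> dist ((f ^^ t) Q) (Ps ! ((i + t) mod length Ps)) < \<epsilon>)) \<and>
     (\<exists>\<delta>>0. \<forall>i<length Ps. \<forall>Q\<in>Om. dist Q (Ps ! i) < \<delta> \<longrightarrow>
        (\<lambda>t. dist ((f ^^ t) Q) (Ps ! ((i + t) mod length Ps))) \<longlonglongrightarrow> 0)"

section \<open>Eigenvectors and transversality\<close>

definition eigenvector :: "real ^ 2 ^ 2 \<Rightarrow> real \<Rightarrow> plane \<Rightarrow> bool" where
  "eigenvector A c v \<longleftrightarrow> v \<noteq> 0 \<and> A *v v = c *\<^sub>R v"

text \<open>\<open>P\<close> plus the eigenspace of \<open>c\<close>; a line when \<open>A\<close> has two distinct real eigenvalues, \<open>c\<close> one of them.\<close>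

definition eigenline :: "real ^ 2 ^ 2 \<Rightarrow> real \<Rightarrow> plane \<Rightarrow> plane set" where
  "eigenline A c P = {P + v | v. A *v v = c *\<^sub>R v}"

text \<open>
  The line \<open>L\<close> meets \<open>S\<close> transversely at \<open>Z\<close>: near \<open>Z\<close> the set \<open>S\<close> is a single smooth embedded
  curve, and the tangent line of this curve at \<open>Z\<close> is not \<open>L\<close>.
\<close>

definition transverse_at :: "plane set \<Rightarrow> plane set \<Rightarrow> plane \<Rightarrow> bool" where
  "transverse_at L S Z \<longleftrightarrow> Z \<in> L \<inter> S \<and>
     (\<exists>V (\<epsilon>::real) c g. open V \<and> Z \<in> V \<and> \<epsilon> > 0 \<and>
        smooth_on c {-\<epsilon><..<\<epsilon>} \<and> homeomorphism {-\<epsilon><..<\<epsilon>} (S \<inter> V) c g \<and> c 0 = Z \<and>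
        (\<forall>t\<in>{-\<epsilon><..<\<epsilon>}. vector_derivative c (at t) \<noteq> 0) \<and>
        Z + vector_derivative c (at 0) \<notin> L)"

text \<open>
  Smooth continuations on \<open>U\<close> of a saddle \<open>X\<close>-cycle \<open>Ps\<close>, the eigenvalues \<open>a\<close>, \<open>b\<close>, an eigenvector
  \<open>qs\<close> for \<open>a\<close> and an intersection point \<open>Z\<close> of the unstable line with the switching set. That \<open>Z\<close>
  lies on the unstable line is expressed by \<open>Z - P\<^sub>0\<close> being an eigenvector for \<open>b\<close>.
\<close>

definition saddle_continuation ::
    "plane set \<Rightarrow> plane set \<Rightarrow> nat \<Rightarrow> (plane \<Rightarrow> nat \<Rightarrow> plane set) \<Rightarrow> (plane \<Rightarrow> nat \<Rightarrow> plane \<Rightarrow> plane) \<Rightarrow>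
     nat list \<Rightarrow> (plane \<Rightarrow> plane list) \<Rightarrow> (plane \<Rightarrow> real) \<Rightarrow> (plane \<Rightarrow> real) \<Rightarrow>
     (plane \<Rightarrow> plane) \<Rightarrow> (plane \<Rightarrow> plane) \<Rightarrow> bool" where
  "saddle_continuation U Om m R F X Ps a b qs Z \<longleftrightarrow>
     (\<forall>i<length X. smooth_on (\<lambda>\<mu>. Ps \<mu> ! i) U) \<and>
     smooth_on a U \<and> smooth_on b U \<and> smooth_on qs U \<and> smooth_on Z U \<and>
     (\<forall>\<mu>\<in>U. is_cycle (F \<mu>) X (Ps \<mu>) \<and>
        0 < \<bar>a \<mu>\<bar> \<and> \<bar>a \<mu>\<bar> < 1 \<and> 1 < b \<mu> \<and>
        eigenvector (word_jacobian (F \<mu>) X) (a \<mu>) (qs \<mu>) \<and>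
        eigenvector (word_jacobian (F \<mu>) X) (b \<mu>) (Z \<mu> - Ps \<mu> ! 0) \<and>
        Z \<mu> \<in> switching_set Om m (R \<mu>))"

section \<open>Coordinates and the parameter map\<close>

definition coord_h :: "plane \<Rightarrow> plane \<Rightarrow> plane \<Rightarrow> plane \<Rightarrow> plane" where
  "coord_h P0 qstab qunstab P =
     matrix_inv (transpose (vector [qstab, qunstab] :: real ^ 2 ^ 2)) *v (P - P0)"

definition psi ::
    "(plane \<Rightarrow> nat \<Rightarrow> plane \<Rightarrow> plane) \<Rightarrow> nat list \<Rightarrow> nat list \<Rightarrow>
     (plane \<Rightarrow> plane list) \<Rightarrow> (plane \<Rightarrow> plane) \<Rightarrow> (plane \<Rightarrow> plane) \<Rightarrow> plane \<Rightarrow> plane" where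
  "psi F X Y Ps qs Z \<mu> =
     (let h = coord_h (Ps \<mu> ! 0) (qs \<mu>) (Z \<mu> - Ps \<mu> ! 0);
          fX = word_map (F \<mu>) X; fY = word_map (F \<mu>) Y
      in vector [h (fY (fX (Z \<mu>))) $ 2, h (fY (Z \<mu>)) $ 2])"

text \<open>
  The triangles in the \<open>(\<eta>, \<nu>)\<close>-plane, \<open>\<eta> = w $ 1\<close>, \<open>\<nu> = w $ 2\<close>; the argument \<open>s\<close> is \<open>1\<close> for
  \<open>\<Delta>\<^sup>+\<close> and \<open>-1\<close> for \<open>\<Delta>\<^sup>-\<close>.
\<close>

definition Delta_set :: "real \<Rightarrow> real \<Rightarrow> nat \<Rightarrow> real \<Rightarrow> plane set" where
  "Delta_set \<sigma> \<gamma> k s =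
     {w. w $ 1 < \<sigma> powi (- (int k - 1)) + s * \<gamma> ^ k \<and>
         w $ 2 > \<sigma> powi (- int k) - s * \<gamma> ^ k \<and>
         w $ 2 < w $ 1 + (\<sigma> - 1) * \<sigma> powi (- int k) + s * \<gamma> ^ k}"

definition stable_cycle_params ::
    "plane set \<Rightarrow> nat \<Rightarrow> (plane \<Rightarrow> nat \<Rightarrow> plane set) \<Rightarrow> (plane \<Rightarrow> nat \<Rightarrow> plane \<Rightarrow> plane) \<Rightarrow>
     nat list \<Rightarrow> nat list \<Rightarrow> plane set \<Rightarrow> plane set \<Rightarrow> nat \<Rightarrow> plane set" where
  "stable_cycle_params Om m R F X Y M N k =
     {\<mu> \<in> N. \<exists>Qs. admissible_cycle Om m (R \<mu>) (F \<mu>) (word_pow X k @ Y) Qs \<and>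
        asymptotically_stable Om (pl_map m (R \<mu>) (F \<mu>)) Qs \<and>
        Qs ! (k * length X) \<in> M}"

end

theory Submission
  imports Defs
begin

text \<open>
  Only the geometry of the triangles and the local invertibility of \<open>\<psi>\<close> matter, because the sets
  \<open>S\<^sub>k\<close> are squeezed between preimages of \<open>\<Delta>\<^sup>-\<^sub>k\<close> and \<open>\<Delta>\<^sup>+\<^sub>k\<close>.

  Drop the error terms \<open>\<gamma>\<^sup>k\<close> and rescale the \<open>(\<eta>, \<nu>)\<close>-plane by \<open>\<sigma>\<^sup>k\<close>. The triangle of index \<open>k\<close> lies
  above the line \<open>\<nu> = 1\<close>, and the top vertex of the triangle of index \<open>k + j\<close> has
  \<open>\<nu> = \<sigma>\<^sup>-\<^sup>j (2 \<sigma> - 1)\<close>. If \<open>j \<ge> 2\<close>, this vertex lies strictly below that line,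
  since \<open>\<sigma>\<^sup>2 - (2 \<sigma> - 1) = (\<sigma> - 1)\<^sup>2 > 0\<close>. If \<open>j = 1\<close>, it lies strictly above, since \<open>\<sigma> < 2 \<sigma> - 1\<close>, and
  the two triangles overlap in an open set. The assumption \<open>\<bar>\<lambda>\<bar> \<sigma> < 1\<close> says precisely that
  \<open>\<gamma> \<sigma> < 1\<close>, so that after rescaling the error terms \<open>(\<gamma> \<sigma>)\<^sup>k\<close> tend to zero and both conclusions
  survive for large \<open>k\<close>: these are \<open>Delta_set_disjoint\<close> and \<open>Delta_set_consecutive\<close>.

  Disjointness of the \<open>\<Delta>\<^sup>+\<close> passes to preimages at once. For \<open>j = 1\<close> the common points of the \<open>\<Delta>\<^sup>-\<close>
  tend to the origin, and they are values of \<open>\<psi>\<close> on \<open>N\<close> as soon as \<open>\<psi>\<close> maps \<open>N\<close> onto a neighbourhood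
  of the origin. Now \<open>\<psi>\<close> is differentiable near the origin of the parameter plane
  (\<open>psi_differentiable\<close>), vanishes at it by the homoclinic condition (\<open>psi_eq_0\<close>) and has an
  invertible derivative at it, so the open mapping theorem of Sussmann applies
  (\<open>open_mapping_at_regular_point\<close>).
\<close>

section \<open>The second coordinate with respect to a basis of the plane\<close>

definition cross2 :: "plane \<Rightarrow> plane \<Rightarrow> real" where
  "cross2 u v = u $ 1 * v $ 2 - u $ 2 * v $ 1"

lemma plane_eq_iff: "u = v \<longleftrightarrow> u $ 1 = v $ 1 \<and> u $ 2 = v $ 2" for u v :: plane
  by (simp add: vec_eq_iff forall_2)

lemma cross2_cramer: "cross2 u v *\<^sub>R w = cross2 w v *\<^sub>R u + cross2 u w *\<^sub>R v"
  by (simp add: plane_eq_iff cross2_def algebra_simps)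

lemma matrix_mul_matrix_inv:
  assumes "invertible A"
  shows "A ** matrix_inv A = mat 1"
  using someI_ex[OF assms[unfolded invertible_def]] by (simp add: matrix_inv_def)

text \<open>Cramer's rule for the system \<open>P - P\<^sub>0 = c\<^sub>1 q + c\<^sub>2 r\<close>.\<close>

lemma coord_h_2:
  assumes "cross2 q r \<noteq> 0"
  shows "coord_h P0 q r P $ 2 = cross2 q (P - P0) / cross2 q r"
proof -
  define T :: "real ^ 2 ^ 2" where "T = transpose (vector [q, r])"
  define c where "c = coord_h P0 q r P"
  have T: "T $ i $ 1 = q $ i" "T $ i $ 2 = r $ i" for i
    by (simp_all add: T_def transpose_def)
  have "det T \<noteq> 0"
    using assms by (simp add: det_2 T cross2_def algebra_simps)
  then have "T ** matrix_inv T = mat 1"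
    by (simp add: invertible_det_nz matrix_mul_matrix_inv)
  then have "T *v c = P - P0"
    by (simp add: c_def coord_h_def T_def matrix_vector_mul_assoc)
  then have "(P - P0) $ i = q $ i * c $ 1 + r $ i * c $ 2" for i
    by (metis (no_types, lifting) T matrix_vector_mult_def sum_2 vec_lambda_beta)
  then have "cross2 q (P - P0) = cross2 q r * c $ 2"
    unfolding cross2_def by (simp only: algebra_simps)
  with assms show ?thesis
    by (simp add: c_def)
qed

text \<open>Two independent eigenvectors for the same \<open>a\<close> would span the plane and leave no room for \<open>b\<close>.\<close>

lemma eigenvectors_parallel:
  assumes b: "eigenvector A b r" and "a \<noteq> b"
    and u: "A *v u = a *\<^sub>R u" and v: "A *v v = a *\<^sub>R v"
  shows "cross2 u v = 0"
proof -
  have r: "A *v r = b *\<^sub>R r" "r \<noteq> 0"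
    using b by (auto simp: eigenvector_def)
  have "(cross2 u v * b) *\<^sub>R r = A *v (cross2 u v *\<^sub>R r)"
    by (simp add: matrix_vector_mult_scaleR r)
  also have "\<dots> = a *\<^sub>R (cross2 r v *\<^sub>R u + cross2 u r *\<^sub>R v)"
    unfolding cross2_cramer[of u v r]
    by (simp add: matrix_vector_right_distrib matrix_vector_mult_scaleR u v scaleR_right_distrib
        mult.commute)
  also have "\<dots> = (cross2 u v * a) *\<^sub>R r"
    by (simp add: cross2_cramer[symmetric] mult.commute)
  finally show ?thesis
    using r \<open>a \<noteq> b\<close> by simp
qed

lemma eigenvectors_independent:
  assumes a: "eigenvector A a q" and b: "eigenvector A b r" and "a \<noteq> b"
  shows "cross2 q r \<noteq> 0"
proof
  assume 0: "cross2 q r = 0"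
  have ev: "A *v q = a *\<^sub>R q" "q \<noteq> 0" "A *v r = b *\<^sub>R r" "r \<noteq> 0"
    using a b by (auto simp: eigenvector_def)
  have par: "\<alpha> *\<^sub>R r = \<beta> *\<^sub>R q" if "\<alpha> = q $ i" "\<beta> = r $ i" for \<alpha> \<beta> and i :: 2
    using 0 that exhaust_2[of i] by (auto simp: plane_eq_iff cross2_def mult.commute)
  obtain i where i: "q $ i \<noteq> 0"
    using ev by (auto simp: vec_eq_iff)
  have "r = (r $ i / q $ i) *\<^sub>R q"
    using par[of "q $ i" i "r $ i"] i
    by (metis divide_inverse_commute left_inverse scaleR_one scaleR_scaleR)
  then have "A *v r = a *\<^sub>R r"
    by (metis ev(1) matrix_vector_mult_scaleR scaleR_left_commute)
  with ev \<open>a \<noteq> b\<close> show False by simp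
qed

section \<open>Differentiability of the parameter map\<close>

lemma smooth_on_imp_differentiable:
  assumes "smooth_on f S" "x \<in> S"
  shows "f differentiable (at x)"
  using assms unfolding smooth_on_def by (metis times_differentiable_on.simps(2))

lemma differentiable_vec_nth:
  assumes "f differentiable (at x)"
  shows "(\<lambda>x. f x $ i) differentiable (at x)"
  using assms unfolding differentiable_def
  by (blast intro: bounded_linear.has_derivative[OF bounded_linear_vec_nth])

lemma differentiable_vector_2:
  fixes f g :: "'a::real_normed_vector \<Rightarrow> real"
  assumes "f differentiable (at x)" "g differentiable (at x)"
  shows "(\<lambda>x. vector [f x, g x] :: plane) differentiable (at x)"
proof -
  have "(\<lambda>x. vector [f x, g x] :: plane) = (\<lambda>x. f x *\<^sub>R axis 1 1 + g x *\<^sub>R axis 2 1)"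
    by (auto simp: plane_eq_iff axis_def)
  then show ?thesis
    using assms by simp
qed

lemma differentiable_cross2:
  assumes "f differentiable (at x)" "g differentiable (at x)"
  shows "(\<lambda>x. cross2 (f x) (g x)) differentiable (at x)"
  unfolding cross2_def using assms by (simp add: differentiable_vec_nth)

text \<open>
  The pieces and the argument vary with \<open>\<mu>\<close> simultaneously, so smoothness of the pieces in the pair
  \<open>(\<mu>, P)\<close> is what makes the chain rule applicable.
\<close>

lemma differentiable_word_map:
  assumes smooth: "\<And>i. i \<in> set W \<Longrightarrow> smooth_on (\<lambda>(\<mu>, P). F \<mu> i P) (U \<times> UNIV)"
    and "\<mu> \<in> U" and "g differentiable (at \<mu>)"
  shows "(\<lambda>\<mu>. word_map (F \<mu>) W (g \<mu>)) differentiable (at \<mu>)"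
  using smooth \<open>g differentiable (at \<mu>)\<close>
proof (induction W arbitrary: g)
  case Nil
  then show ?case by (simp add: word_map_def)
next
  case (Cons i W)
  have "(\<lambda>(\<mu>, P). F \<mu> i P) differentiable (at (\<mu>, g \<mu>))"
    using Cons.prems(1)[of i] \<open>\<mu> \<in> U\<close> by (auto intro: smooth_on_imp_differentiable)
  moreover have "(\<lambda>\<mu>. (\<mu>, g \<mu>)) differentiable (at \<mu>)"
    using Cons.prems(2) by simp
  ultimately have "(\<lambda>\<mu>. F \<mu> i (g \<mu>)) differentiable (at \<mu>)"
    using differentiable_chain_at[of "\<lambda>\<mu>. (\<mu>, g \<mu>)" \<mu> "\<lambda>(\<mu>, P). F \<mu> i P"] by (simp add: o_def)
  then show ?case
    using Cons.IH[of "\<lambda>\<mu>. F \<mu> i (g \<mu>)"] Cons.prems(1) by (simp add: word_map_def)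
qed

lemma saddle_basis:
  assumes "saddle_continuation U Om m R F X Ps a b qs Z" "\<mu> \<in> U"
  shows "cross2 (qs \<mu>) (Z \<mu> - Ps \<mu> ! 0) \<noteq> 0"
proof -
  have "eigenvector (word_jacobian (F \<mu>) X) (a \<mu>) (qs \<mu>)"
    "eigenvector (word_jacobian (F \<mu>) X) (b \<mu>) (Z \<mu> - Ps \<mu> ! 0)" "a \<mu> \<noteq> b \<mu>"
    using assms unfolding saddle_continuation_def by auto
  then show ?thesis
    by (rule eigenvectors_independent)
qed

lemma psi_differentiable:
  assumes family: "smooth_pl_family U Om m R F"
    and words: "X \<noteq> []" "set X \<subseteq> {1..m}" "set Y \<subseteq> {1..m}"
    and continuation: "saddle_continuation U Om m R F X Ps a b qs Z"
    and "\<mu> \<in> U"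
  shows "psi F X Y Ps qs Z differentiable (at \<mu>)"
proof -
  have "open U" and F: "\<And>i. i \<in> {1..m} \<Longrightarrow> smooth_on (\<lambda>(\<mu>, P). F \<mu> i P) (U \<times> UNIV)"
    using family by (auto simp: smooth_pl_family_def)
  define D where "D \<mu> = cross2 (qs \<mu>) (Z \<mu> - Ps \<mu> ! 0)" for \<mu>
  define C where "C g \<mu> = cross2 (qs \<mu>) (word_map (F \<mu>) Y (g \<mu>) - Ps \<mu> ! 0) / D \<mu>" for g \<mu>
  let ?fX = "\<lambda>\<mu>. word_map (F \<mu>) X (Z \<mu>)"
  have P: "(\<lambda>\<mu>. Ps \<mu> ! 0) differentiable (at \<mu>)" and Z: "Z differentiable (at \<mu>)"
    and qs: "qs differentiable (at \<mu>)"
    using continuation words(1) \<open>\<mu> \<in> U\<close> smooth_on_imp_differentiable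
    unfolding saddle_continuation_def by blast+
  have D0: "D \<mu> \<noteq> 0" if "\<mu> \<in> U" for \<mu>
    using saddle_basis[OF continuation that] by (simp add: D_def)
  have C: "C g differentiable (at \<mu>)" if "g differentiable (at \<mu>)" for g
  proof -
    have "(\<lambda>\<mu>. word_map (F \<mu>) Y (g \<mu>)) differentiable (at \<mu>)"
      using that F words \<open>\<mu> \<in> U\<close> by (blast intro: differentiable_word_map)
    moreover have "D differentiable (at \<mu>)"
      unfolding D_def using P Z qs by (simp add: differentiable_cross2)
    ultimately show ?thesis
      unfolding C_def using D0[OF \<open>\<mu> \<in> U\<close>] P qs by (simp add: differentiable_cross2)
  qed
  have "?fX differentiable (at \<mu>)"
    using Z F words \<open>\<mu> \<in> U\<close> by (blast intro: differentiable_word_map)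
  then have "(\<lambda>\<mu>. vector [C ?fX \<mu>, C Z \<mu>] :: plane) differentiable (at \<mu>)"
    using C Z by (blast intro: differentiable_vector_2)
  moreover have "psi F X Y Ps qs Z \<nu> = vector [C ?fX \<nu>, C Z \<nu>]" if "\<nu> \<in> U" for \<nu>
    using D0[OF that] by (simp add: psi_def Let_def coord_h_2 C_def D_def)
  ultimately show ?thesis
    using \<open>open U\<close> \<open>\<mu> \<in> U\<close> unfolding differentiable_def
    by (metis (no_types, lifting) has_derivative_transform_within_open)
qed

text \<open>
  The homoclinic condition puts the images under \<open>Y\<close> of \<open>Z\<close> and of its image under \<open>X\<close> on the
  stable line, where the second coordinate vanishes.
\<close>

lemma psi_eq_0:
  assumes continuation: "saddle_continuation U Om m R F X Ps a b qs Z" and "\<mu> \<in> U"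
    and "word_map (F \<mu>) Y (Z \<mu>) \<in> eigenline (word_jacobian (F \<mu>) X) (a \<mu>) (Ps \<mu> ! 0)"
    and "word_map (F \<mu>) Y (word_map (F \<mu>) X (Z \<mu>))
           \<in> eigenline (word_jacobian (F \<mu>) X) (a \<mu>) (Ps \<mu> ! 0)"
  shows "psi F X Y Ps qs Z \<mu> = 0"
proof -
  let ?A = "word_jacobian (F \<mu>) X" and ?r = "Z \<mu> - Ps \<mu> ! 0"
  have ev: "eigenvector ?A (b \<mu>) ?r" "a \<mu> \<noteq> b \<mu>" "?A *v qs \<mu> = a \<mu> *\<^sub>R qs \<mu>"
    using continuation \<open>\<mu> \<in> U\<close> unfolding saddle_continuation_def eigenvector_def by auto
  have "coord_h (Ps \<mu> ! 0) (qs \<mu>) ?r P $ 2 = 0" if "P \<in> eigenline ?A (a \<mu>) (Ps \<mu> ! 0)" for P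
  proof -
    have "?A *v (P - Ps \<mu> ! 0) = a \<mu> *\<^sub>R (P - Ps \<mu> ! 0)"
      using that by (auto simp: eigenline_def)
    then have "cross2 (qs \<mu>) (P - Ps \<mu> ! 0) = 0"
      using ev eigenvectors_parallel by blast
    then show ?thesis
      using saddle_basis[OF continuation \<open>\<mu> \<in> U\<close>] by (simp add: coord_h_2)
  qed
  with assms(3,4) show ?thesis
    by (simp add: psi_def Let_def plane_eq_iff)
qed

lemma open_mapping_at_regular_point:
  fixes f :: "real ^ 'n \<Rightarrow> real ^ 'n"
  assumes "open U" "x \<in> U" "\<And>y. y \<in> U \<Longrightarrow> f differentiable (at y)"
    and det: "det (jacobian f (at x)) \<noteq> 0"
    and "N \<subseteq> U" "x \<in> interior N"
  shows "f x \<in> interior (f ` N)"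
proof (rule sussmann_open_mapping)
  let ?J = "jacobian f (at x)"
  show "continuous_on U f"
    using assms(3) by (simp add: continuous_at_imp_continuous_on differentiable_imp_continuous_within)
  show "(f has_derivative (*v) ?J) (at x)"
    using assms(2,3) jacobian_works by blast
  show "bounded_linear ((*v) (matrix_inv ?J))"
    by (rule matrix_vector_mul_bounded_linear)
  have "?J ** matrix_inv ?J = mat 1"
    using det by (simp add: invertible_det_nz matrix_mul_matrix_inv)
  then show "(*v) ?J \<circ> (*v) (matrix_inv ?J) = id"
    by (auto simp: fun_eq_iff matrix_vector_mul_assoc)
qed (use assms in auto)

section \<open>The triangles\<close>

lemma gamma_times_sigma:
  fixes \<sigma> \<gamma> lam :: real
  assumes "1 < \<sigma>" "0 < \<bar>lam\<bar>" "\<bar>lam\<bar> * \<sigma> < 1"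
    and \<gamma>: "\<gamma> = max (\<sigma> powr (- 3 / 2)) (\<bar>lam\<bar> powr (1 / 2) * \<sigma> powr (- 1 / 2))"
  shows "0 < \<gamma>" "\<gamma> * \<sigma> < 1"
proof -
  show "0 < \<gamma>"
    using assms by (simp add: less_max_iff_disj)
  have "\<sigma> powr (- 3 / 2) * \<sigma> = \<sigma> powr (- 1 / 2)"
    using \<open>1 < \<sigma>\<close> powr_add[of \<sigma> "- 3 / 2" 1] by simp
  also have "\<dots> < 1"
    using \<open>1 < \<sigma>\<close> powr_less_one by simp
  finally have 1: "\<sigma> powr (- 3 / 2) * \<sigma> < 1" .
  have "\<bar>lam\<bar> powr (1 / 2) * \<sigma> powr (- 1 / 2) * \<sigma> = \<bar>lam\<bar> powr (1 / 2) * \<sigma> powr (1 / 2)"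
    using \<open>1 < \<sigma>\<close> powr_add[of \<sigma> "- 1 / 2" 1] by simp
  also have "\<dots> = (\<bar>lam\<bar> * \<sigma>) powr (1 / 2)"
    using \<open>1 < \<sigma>\<close> by (simp add: powr_mult)
  also have "\<dots> < 1"
    using assms powr_less_mono2[of "1 / 2" "\<bar>lam\<bar> * \<sigma>" 1] by simp
  finally have 2: "\<bar>lam\<bar> powr (1 / 2) * \<sigma> powr (- 1 / 2) * \<sigma> < 1" .
  show "\<gamma> * \<sigma> < 1"
    using 1 2 by (simp add: \<gamma> max_def)
qed

lemma mem_Delta_set:
  assumes "\<sigma> \<noteq> 0"
  shows "w \<in> Delta_set \<sigma> \<gamma> k s \<longleftrightarrow>
    w $ 1 < \<sigma> * (1 / \<sigma>) ^ k + s * \<gamma> ^ k \<and> w $ 2 > (1 / \<sigma>) ^ k - s * \<gamma> ^ k \<and>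
    w $ 2 < w $ 1 + (\<sigma> - 1) * (1 / \<sigma>) ^ k + s * \<gamma> ^ k"
proof -
  have k: "\<sigma> powi (- int k) = (1 / \<sigma>) ^ k"
    by (simp add: power_int_minus power_one_over inverse_eq_divide)
  have "\<sigma> powi (- (int k - 1)) = \<sigma> powi (1 + - int k)"
    by simp
  also have "\<dots> = \<sigma> * \<sigma> powi (- int k)"
    using assms by (subst power_int_add) auto
  finally have k1: "\<sigma> powi (- (int k - 1)) = \<sigma> * (1 / \<sigma>) ^ k"
    by (simp only: k)
  show ?thesis
    unfolding Delta_set_def mem_Collect_eq k k1 by blast
qed

text \<open>
  Without the error terms, the bottom edge of the triangle of index \<open>k\<close> lies above the top vertex of
  that of index \<open>k + j\<close> by at least \<open>\<delta>\<^sup>2 \<sigma>\<^sup>-\<^sup>k\<close>, where \<open>\<delta> = (\<sigma> - 1) / \<sigma>\<close>. The error terms lower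
  the edge by \<open>\<gamma>\<^sup>k\<close> and raise the vertex by \<open>2 \<gamma>\<^sup>k\<^sup>+\<^sup>j\<close>.
\<close>

lemma Delta_set_disjoint:
  assumes "1 < \<sigma>" "0 < \<gamma>" "\<gamma> * \<sigma> < 1" "2 \<le> j"
    and small: "3 * (\<gamma> * \<sigma>) ^ k < ((\<sigma> - 1) / \<sigma>)\<^sup>2"
  shows "Delta_set \<sigma> \<gamma> k 1 \<inter> Delta_set \<sigma> \<gamma> (k + j) 1 = {}"
proof (rule ccontr)
  assume "\<not> ?thesis"
  then obtain w where w: "w \<in> Delta_set \<sigma> \<gamma> k 1" "w \<in> Delta_set \<sigma> \<gamma> (k + j) 1"
    by blast
  define s where "s = (1 / \<sigma>) ^ k"
  have "0 < s" and \<sigma>: "\<sigma> \<noteq> 0"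
    using \<open>1 < \<sigma>\<close> by (simp_all add: s_def)
  have "\<gamma> < 1"
    using assms(1-3) by (smt (verit) mult_less_cancel_left1)
  then have "\<gamma> ^ (k + j) \<le> \<gamma> ^ k"
    using \<open>0 < \<gamma>\<close> by (intro power_decreasing) auto
  moreover have "s - \<gamma> ^ k < w $ 2"
    using w(1) \<open>1 < \<sigma>\<close> by (simp add: mem_Delta_set s_def)
  moreover have "w $ 2 < (2 * \<sigma> - 1) * (1 / \<sigma>) ^ (k + j) + 2 * \<gamma> ^ (k + j)"
    using w(2) unfolding mem_Delta_set[OF \<sigma>]
    by (simp add: algebra_simps)
  moreover have "(2 * \<sigma> - 1) * (1 / \<sigma>) ^ (k + j) \<le> (2 * \<sigma> - 1) * (s * (1 / \<sigma>)\<^sup>2)"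
  proof -
    have "(1 / \<sigma>) ^ j \<le> (1 / \<sigma>)\<^sup>2"
      using \<open>1 < \<sigma>\<close> \<open>2 \<le> j\<close> by (intro power_decreasing) auto
    then show ?thesis
      using \<open>1 < \<sigma>\<close> \<open>0 < s\<close> by (simp add: power_add s_def del: power_one_over)
  qed
  moreover have "(2 * \<sigma> - 1) * (s * (1 / \<sigma>)\<^sup>2) = s - s * ((\<sigma> - 1) / \<sigma>)\<^sup>2"
    using \<open>1 < \<sigma>\<close> by (simp add: field_simps power2_eq_square)
  moreover have "3 * \<gamma> ^ k < s * ((\<sigma> - 1) / \<sigma>)\<^sup>2"
    using mult_strict_left_mono[OF small \<open>0 < s\<close>] \<open>1 < \<sigma>\<close>
    by (simp add: s_def power_mult_distrib power_one_over)
  ultimately show False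
    by linarith
qed

text \<open>
  After rescaling by \<open>\<sigma>\<^sup>k\<close> and without the error terms, the binding constraints are \<open>\<nu> > 1\<close> from the
  triangle of index \<open>k\<close>, and \<open>\<eta> < 1\<close> and \<open>\<nu> < \<eta> + \<delta>\<close> from that of index \<open>k + 1\<close>. The
  witness is the centroid of the triangle that they bound, which satisfies each of them with the same
  margin \<open>\<delta> / 3\<close>.
\<close>

lemma Delta_set_consecutive:
  assumes "1 < \<sigma>" "0 < \<gamma>" "\<gamma> * \<sigma> < 1"
    and \<delta>: "\<delta> = (\<sigma> - 1) / \<sigma>" and small: "(\<gamma> * \<sigma>) ^ k < \<delta> / 3"
  shows "(1 / \<sigma>) ^ k *\<^sub>R vector [1 - \<delta> / 3, 1 + \<delta> / 3]
    \<in> Delta_set \<sigma> \<gamma> k (-1) \<inter> Delta_set \<sigma> \<gamma> (k + 1) (-1)"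
proof -
  define s where "s = (1 / \<sigma>) ^ k"
  have "0 < s" "0 < \<delta>" and \<sigma>: "\<sigma> \<noteq> 0"
    using \<open>1 < \<sigma>\<close> by (simp_all add: s_def \<delta>)
  have "\<gamma> < 1"
    using assms(1-3) by (smt (verit) mult_less_cancel_left1)
  then have 1: "\<gamma> ^ (k + 1) \<le> \<gamma> ^ k"
    using \<open>0 < \<gamma>\<close> by (intro power_decreasing) auto
  have 2: "\<gamma> ^ k < s * \<delta> / 3"
    using mult_strict_left_mono[OF small \<open>0 < s\<close>] \<open>1 < \<sigma>\<close>
    by (simp add: s_def power_mult_distrib power_one_over)
  have 3: "(1 / \<sigma>) ^ (k + 1) = s - s * \<delta>" "\<sigma> * (s - s * \<delta>) = s"
    "(\<sigma> - 1) * (s - s * \<delta>) = s * \<delta>"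
    using \<open>1 < \<sigma>\<close> by (simp_all add: s_def \<delta> field_simps)
  have "\<delta> \<le> \<sigma> - 1"
    using \<open>1 < \<sigma>\<close> divide_left_mono[of 1 \<sigma> "\<sigma> - 1"] by (simp add: \<delta>)
  then have "s * \<delta> \<le> s * (\<sigma> - 1)"
    using \<open>0 < s\<close> by simp
  then have 4: "s + s * \<delta> \<le> \<sigma> * s" "s * \<delta> \<le> (\<sigma> - 1) * s"
    by (simp_all add: algebra_simps)
  have 5: "0 < s * \<delta>"
    using \<open>0 < s\<close> \<open>0 < \<delta>\<close> by simp
  have w: "(s *\<^sub>R vector [1 - \<delta> / 3, 1 + \<delta> / 3] :: plane) $ 1 = s - s * \<delta> / 3"
    "(s *\<^sub>R vector [1 - \<delta> / 3, 1 + \<delta> / 3] :: plane) $ 2 = s + s * \<delta> / 3"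
    by (simp_all add: algebra_simps)
  show ?thesis
    unfolding Int_iff mem_Delta_set[OF \<sigma>] s_def[symmetric] w 3
    using 1 2 4 5 by (intro conjI; linarith)
qed

section \<open>Overlap of the stability regions\<close>

theorem proposition3p3:
  fixes U Om :: "plane set" and m :: nat
    and R :: "plane \<Rightarrow> nat \<Rightarrow> plane set"
    and F :: "plane \<Rightarrow> nat \<Rightarrow> plane \<Rightarrow> plane"
    and X Y :: "nat list"
    and Ps :: "plane \<Rightarrow> plane list"
    and a b :: "plane \<Rightarrow> real"
    and qs Z :: "plane \<Rightarrow> plane"
    and B M N :: "plane set"
    and \<sigma> \<gamma> lam :: real
    and S :: "nat \<Rightarrow> plane set"
    and j :: nat
  assumes family: "smooth_pl_family U Om m R F"
    and words: "X \<noteq> []" "Y \<noteq> []" "set X \<subseteq> {1..m}" "set Y \<subseteq> {1..m}" "X ! 0 \<noteq> Y ! 0"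
    and continuation: "saddle_continuation U Om m R F X Ps a b qs Z"
    and cond1: "admissible_cycle Om m (R 0) (F 0) X (Ps 0)"
      "set (Ps 0) \<inter> switching_set Om m (R 0) = {}"
    and cond2: "transverse_at (eigenline (word_jacobian (F 0) X) (b 0) (Ps 0 ! 0))
                  (switching_set Om m (R 0)) (Z 0)"
    and cond3: "open_segment (Ps 0 ! 0) (Z 0) \<subseteq> interior (word_region Om m (R 0) (F 0) X)"
      "open_segment (Z 0) (word_map (F 0) X (Z 0)) \<subseteq> interior (word_region Om m (R 0) (F 0) Y)"
    and cond4: "compact B" "convex B" "Ps 0 ! 0 \<in> B"
      "B \<subseteq> interior (word_region Om m (R 0) (F 0) (X @ X))"
      "word_map (F 0) Y (Z 0) \<in> B \<inter> eigenline (word_jacobian (F 0) X) (a 0) (Ps 0 ! 0)"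
      "word_map (F 0) Y (word_map (F 0) X (Z 0))
         \<in> B \<inter> eigenline (word_jacobian (F 0) X) (a 0) (Ps 0 ! 0)"
    and eigenvalues: "lam = a 0" "\<sigma> = b 0" "\<bar>lam\<bar> * \<sigma> < 1"
    and gamma: "\<gamma> = max (\<sigma> powr (- 3 / 2)) (\<bar>lam\<bar> powr (1 / 2) * \<sigma> powr (- 1 / 2))"
    and nondegenerate: "det (jacobian (psi F X Y Ps qs Z) (at 0)) \<noteq> 0"
    and S_eq: "S = stable_cycle_params Om m R F X Y M N"
    and nbhd_M: "open_segment (Z 0) (word_map (F 0) X (Z 0)) \<subseteq> interior M"
    and nbhd_N: "0 \<in> interior N" "N \<subseteq> U"
    and sandwich: "\<exists>kmin. \<forall>k\<ge>kmin.
      {\<mu> \<in> N. psi F X Y Ps qs Z \<mu> \<in> Delta_set \<sigma> \<gamma> k (-1)} \<subseteq> S k \<and>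
      S k \<subseteq> {\<mu> \<in> N. psi F X Y Ps qs Z \<mu> \<in> Delta_set \<sigma> \<gamma> k 1}"
    and j: "j \<ge> 1"
  shows "\<forall>\<^sub>F k in sequentially. S k \<inter> S (k + j) = {} \<longleftrightarrow> j > 1"
proof -
  let ?\<psi> = "psi F X Y Ps qs Z"
  define \<delta> where "\<delta> = (\<sigma> - 1) / \<sigma>"
  have U: "open U" "0 \<in> U"
    using family by (auto simp: smooth_pl_family_def)
  then have \<sigma>: "1 < \<sigma>" and lam: "0 < \<bar>lam\<bar>"
    using continuation eigenvalues by (auto simp: saddle_continuation_def)
  then have "0 < \<delta>"
    by (simp add: \<delta>_def)
  have \<gamma>: "0 < \<gamma>" "\<gamma> * \<sigma> < 1"
    using gamma_times_sigma[OF \<sigma> lam eigenvalues(3) gamma] by auto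
  have lim: "(\<lambda>k. (\<gamma> * \<sigma>) ^ k) \<longlonglongrightarrow> 0"
    using \<gamma> \<sigma> by (intro LIMSEQ_power_zero) simp
  have small: "\<forall>\<^sub>F k in sequentially. (\<gamma> * \<sigma>) ^ k < c" if "0 < c" for c
    using order_tendstoD(2)[OF lim that] .
  obtain kmin where kmin: "\<And>k. k \<ge> kmin \<Longrightarrow>
      {\<mu> \<in> N. ?\<psi> \<mu> \<in> Delta_set \<sigma> \<gamma> k (-1)} \<subseteq> S k \<and> S k \<subseteq> {\<mu> \<in> N. ?\<psi> \<mu> \<in> Delta_set \<sigma> \<gamma> k 1}"
    using sandwich by blast
  show ?thesis
  proof (cases "j = 1")
    case True
    have "?\<psi> 0 \<in> interior (?\<psi> ` N)"
      using U nbhd_N nondegenerate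
        psi_differentiable[OF family words(1) words(3) words(4) continuation]
      by (intro open_mapping_at_regular_point) auto
    moreover have "?\<psi> 0 = 0"
      using psi_eq_0[OF continuation U(2)] cond4(5,6) by simp
    ultimately have nbhd: "0 \<in> interior (?\<psi> ` N)"
      by simp
    define w :: "nat \<Rightarrow> plane" where "w k = (1 / \<sigma>) ^ k *\<^sub>R vector [1 - \<delta> / 3, 1 + \<delta> / 3]" for k
    have "(\<lambda>k. (1 / \<sigma>) ^ k) \<longlonglongrightarrow> 0"
      using \<sigma> by (intro LIMSEQ_power_zero) simp
    then have "w \<longlonglongrightarrow> 0"
      unfolding w_def by (auto intro: tendsto_eq_intros)
    then have "\<forall>\<^sub>F k in sequentially. w k \<in> interior (?\<psi> ` N)"
      using nbhd by (simp add: topological_tendstoD)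
    moreover have "\<forall>\<^sub>F k in sequentially. (\<gamma> * \<sigma>) ^ k < \<delta> / 3"
      using small[of "\<delta> / 3"] \<open>0 < \<delta>\<close> by simp
    ultimately show ?thesis
      using eventually_ge_at_top[of kmin]
    proof eventually_elim
      case (elim k)
      then obtain \<mu> where \<mu>: "\<mu> \<in> N" "?\<psi> \<mu> = w k"
        using interior_subset by (metis imageE subsetD)
      then have "?\<psi> \<mu> \<in> Delta_set \<sigma> \<gamma> k (-1) \<inter> Delta_set \<sigma> \<gamma> (k + 1) (-1)"
        using Delta_set_consecutive[OF \<sigma> \<gamma> \<delta>_def elim(2)] by (simp add: w_def)
      then have "\<mu> \<in> S k \<inter> S (k + 1)"
        using kmin[of k] kmin[of "k + 1"] elim(3) \<mu>(1) by auto
      then show ?case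
        using True by auto
    qed
  next
    case False
    then have "2 \<le> j"
      using j by simp
    have "\<forall>\<^sub>F k in sequentially. (\<gamma> * \<sigma>) ^ k < \<delta>\<^sup>2 / 3"
      using small[of "\<delta>\<^sup>2 / 3"] \<open>0 < \<delta>\<close> by simp
    then show ?thesis
      using eventually_ge_at_top[of kmin]
    proof eventually_elim
      case (elim k)
      then have "Delta_set \<sigma> \<gamma> k 1 \<inter> Delta_set \<sigma> \<gamma> (k + j) 1 = {}"
        using \<sigma> \<gamma> \<open>2 \<le> j\<close> by (intro Delta_set_disjoint) (auto simp: \<delta>_def)
      then have "S k \<inter> S (k + j) = {}"
        using kmin[of k] kmin[of "k + j"] elim(2) by auto
      then show ?case
        using \<open>2 \<le> j\<close> by simp
    qed
  qed
qed

end
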